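(* Let $p$ and $q$ be positive integers with $p<q$ (not necessarily coprime). Then $m_{p/q}<m_{p/(q+1)}$ and $m_{p/q}<m_{(p+1)/q}$, where $m_{r/s}$ is the number of perfect matchings of the lattice path snake graph $\mathcal G_{r/s}$ described in the context.
   Context: For positive integers $r\le s$, let $\ell_{r/s}$ be the line segment from $(0,0)$ to $(s,r)$, and let $L_{r/s}$ be the unique lattice path in $\mathbb Z\times\mathbb Z$ from $(0,0)$ to $(s,r)$ using unit east and north steps, lying on or below $\ell_{r/s}$, such that no lattice points lie strictly between $L_{r/s}$ and $\ell_{r/s}$ (when $\gcd(r,s)=1$ this is the Christoffel path, lying strictly below $\ell_{r/s}$ except at its endpoints). The lattice path snake graph $\mathcal G_{r/s}$ is the planar graph formed by squares (tiles) of side length $1/2$ lying on the path $L_{r/s}$ (i.e. the tiles with vertices in $\tfrac12\mathbb Z^2$ lying weakly above/left of $L_{r/s}$ inside the rectangle $[0,s]\times[0,r]$ and touching $L_{r/s}$), starting with the tile whose south-west vertex is $(0.5,0)$ and ending with the tile whose north-east vertex is $(s,r-0.5)$; consecutive tiles are glued along an edge, each tile lying to the right of or above the previous one. The vertices and edges of $\mathcal G_{r/s}$ are those of its tiles. A perfect matching is a set of edges such that every vertex lies on exactly one of them. Define $m_{r/s}$ to be the number of perfect matchings of $\mathcal G_{r/s}$. When $\gcd(r,s)=1$ and $r<s$, $m_{r/s}$ coincides with the Markov number indexed by $r/s$ via the Farey tree (e.g. $m_{3/5}=433$). *)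

theory Defs
  imports Main
begin

type_synonym point = "int \<times> int"

definition unit_step :: "point \<Rightarrow> point \<Rightarrow> bool" where
  "unit_step P Q \<longleftrightarrow> Q = (fst P + 1, snd P) \<or> Q = (fst P, snd P + 1)"

definition lattice_path :: "point \<Rightarrow> point \<Rightarrow> point list \<Rightarrow> bool" where
  "lattice_path P Q L \<longleftrightarrow> L \<noteq> [] \<and> hd L = P \<and> last L = Q \<and> successively unit_step L"

text \<open>
  The segment from \<open>(0, 0)\<close> to \<open>(s, r)\<close> is given by \<open>s * y = r * x\<close>. The last conjunct says that every
  lattice point of the closed region bounded by the path and the segment lies on the path. In
  particular the path runs through all lattice points of the segment; for \<open>r\<close>, \<open>s\<close> not coprime,
  the path would not be unique if lattice points on the segment could be missed.
\<close>
definition is_lower_path :: "int \<Rightarrow> int \<Rightarrow> point list \<Rightarrow> bool" where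
  "is_lower_path r s L \<longleftrightarrow>
     lattice_path (0, 0) (s, r) L \<and>
     (\<forall>(x, y) \<in> set L. s * y \<le> r * x) \<and>
     (\<forall>(x, b) \<in> set L. \<forall>y. b \<le> y \<and> s * y \<le> r * x \<longrightarrow> (x, y) \<in> set L)"

definition lower_path :: "int \<Rightarrow> int \<Rightarrow> point list" where
  "lower_path r s = (THE L. is_lower_path r s L)"

lemma is_lower_path_step:
  assumes L: "is_lower_path r s L" and k: "Suc k < length L" and xy: "L ! k = (x, y)" and "0 < s"
  shows "L ! Suc k = (if s * (y + 1) \<le> r * x then (x, y + 1) else (x + 1, y))"
proof -
  have succ: "successively unit_step L"
    using L by (simp add: is_lower_path_def lattice_path_def)
  have st: "unit_step (L ! i) (L ! Suc i)" if "Suc i < length L" for i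
    using succ that by (simp add: successively_conv_nth)
  have mono: "fst (L ! i) \<le> fst (L ! j) \<and> snd (L ! i) \<le> snd (L ! j)"
    if "i \<le> j" "j < length L" for i j
    using that
  proof (induction j rule: dec_induct)
    case (step n)
    then show ?case using st[of n] by (auto simp: unit_step_def)
  qed auto
  have below: "s * b \<le> r * a" if "(a, b) \<in> set L" for a b
    using L that by (auto simp: is_lower_path_def)
  have reg: "(a, c) \<in> set L" if "(a, b) \<in> set L" "b \<le> c" "s * c \<le> r * a" for a b c
    using L that unfolding is_lower_path_def by blast
  have inL: "(x, y) \<in> set L" using xy k by (metis Suc_lessD nth_mem)
  consider "L ! Suc k = (x + 1, y)" | "L ! Suc k = (x, y + 1)"
    using st[OF k] xy by (auto simp: unit_step_def)
  then show ?thesis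
  proof cases
    case 1
    have "\<not> s * (y + 1) \<le> r * x"
    proof
      assume "s * (y + 1) \<le> r * x"
      then have "(x, y + 1) \<in> set L" using reg[OF inL, of "y + 1"] by simp
      then obtain i where i: "i < length L" "L ! i = (x, y + 1)" by (metis in_set_conv_nth)
      show False
      proof (cases "i \<le> k")
        case True
        then show False using mono[of i k] i xy k by simp
      next
        case False
        then show False using mono[of "Suc k" i] i 1 by simp
      qed
    qed
    then show ?thesis using 1 by simp
  next
    case 2
    then have "s * (y + 1) \<le> r * x" using below k by (metis nth_mem)
    then show ?thesis using 2 by simp
  qed
qed

lemma is_lower_path_nth_sum:
  assumes "is_lower_path r s L" "k < length L"
  shows "fst (L ! k) + snd (L ! k) = int k"
  using assms(2)
proof (induction k)
  case 0
  then show ?case using assms(1)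
    by (simp add: is_lower_path_def lattice_path_def hd_conv_nth)
next
  case (Suc k)
  have "unit_step (L ! k) (L ! Suc k)"
    using assms(1) Suc.prems
    by (simp add: is_lower_path_def lattice_path_def successively_conv_nth)
  then show ?case using Suc by (auto simp: unit_step_def)
qed

lemma is_lower_path_length:
  assumes "is_lower_path r s L"
  shows "int (length L) = r + s + 1"
proof -
  have ne: "L \<noteq> []" and "last L = (s, r)"
    using assms by (auto simp: is_lower_path_def lattice_path_def)
  then have "L ! (length L - 1) = (s, r)" by (simp add: last_conv_nth)
  moreover have "length L - 1 < length L" using ne by simp
  ultimately have "s + r = int (length L - 1)"
    using is_lower_path_nth_sum[OF assms] by fastforce
  then show ?thesis using ne by (cases L) auto
qed

lemma is_lower_path_unique:
  assumes L: "is_lower_path r s L" and M: "is_lower_path r s M" and "0 < s"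
  shows "L = M"
proof (rule nth_equalityI)
  show len: "length L = length M"
    using is_lower_path_length[OF L] is_lower_path_length[OF M] by simp
  fix k assume "k < length L"
  then show "L ! k = M ! k"
  proof (induction k)
    case 0
    then show ?case using L M
      by (auto simp: is_lower_path_def lattice_path_def hd_conv_nth)
  next
    case (Suc k)
    obtain x y where xy: "L ! k = (x, y)" by fastforce
    with Suc have "M ! k = (x, y)" by simp
    then show ?case
      using is_lower_path_step[OF L _ xy \<open>0 < s\<close>] is_lower_path_step[OF M _ _ \<open>0 < s\<close>] Suc.prems len
      by simp
  qed
qed

lemma is_lower_path_exists:
  assumes r: "0 < r" and s: "0 < s"
  shows "\<exists>L. is_lower_path r s L"
proof -
  define f where "f = (\<lambda>(x, y). if s * (y + 1) \<le> r * x then (x, y + 1) else (x + 1, y))"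
  define g where "g k = (f ^^ k) (0, 0)" for k :: nat
  define n where "n = nat (r + s)"
  have g0: "g 0 = (0, 0)" and gS: "g (Suc k) = f (g k)" for k by (simp_all add: g_def)
  have inv: "fst (g k) + snd (g k) = int k \<and> s * snd (g k) \<le> r * fst (g k)" for k
  proof (induction k)
    case 0
    then show ?case by (simp add: g0)
  next
    case (Suc k)
    obtain x y where "g k = (x, y)" by fastforce
    then show ?case using Suc r by (auto simp: gS f_def algebra_simps)
  qed
  have bd: "fst (g k) \<le> s \<and> snd (g k) \<le> r" if "k \<le> n" for k
    using that
  proof (induction k)
    case 0
    then show ?case using r s by (simp add: g0)
  next
    case (Suc k)
    obtain x y where xy: "g k = (x, y)" by fastforce
    have h: "x \<le> s" "y \<le> r" "x + y < r + s" 
      using Suc xy inv[of k] r s by (auto simp: n_def)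
    show ?case
    proof (cases "s * (y + 1) \<le> r * x")
      case True
      have "r * x \<le> s * r" using h(1) r by (simp add: mult.commute)
      then have "s * (y + 1) \<le> s * r" using True by linarith
      then have "y + 1 \<le> r" using s by (meson mult_le_cancel_left_pos)
      then show ?thesis using True h xy by (simp add: gS f_def)
    next
      case False
      have "x \<noteq> s"
      proof
        assume "x = s"
        then have "y + 1 \<le> r" using h by simp
        then have "s * (y + 1) \<le> s * r" using s by simp
        then show False using False \<open>x = s\<close> by (simp add: mult.commute)
      qed
      then show ?thesis using False h xy by (simp add: gS f_def)
    qed
  qed
  have gn: "g n = (s, r)"
    using inv[of n] bd[of n] r s by (cases "g n") (auto simp: n_def)
  have up: "g (k + d) = (x, b + int d)" if "g k = (x, b)" "s * (b + int d) \<le> r * x" for k d x b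
    using that
  proof (induction d)
    case (Suc d)
    have "s * (b + int d) \<le> s * (b + int (Suc d))" using s by simp
    then have "s * (b + int d) \<le> r * x" using Suc.prems(2) by linarith
    then have "g (k + d) = (x, b + int d)" using Suc by blast
    then show ?case using Suc.prems(2) by (simp add: gS f_def algebra_simps)
  qed simp
  define L where "L = map g [0..<Suc n]"
  have setL: "set L = g ` {..n}" by (auto simp: L_def simp del: upt_Suc)
  have st: "unit_step (g k) (g (Suc k))" for k
    by (cases "g k") (simp add: gS f_def unit_step_def)
  have "lattice_path (0, 0) (s, r) L"
    unfolding lattice_path_def successively_conv_nth
    using st by (auto simp: L_def hd_map g0 gn last_map hd_conv_nth last_conv_nth nth_append simp del: upt_Suc)
  moreover have "\<forall>(x, y) \<in> set L. s * y \<le> r * x"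
    using inv by (auto simp: setL case_prod_beta)
  moreover have "(x, y) \<in> set L" if xb: "(x, b) \<in> set L" and y: "b \<le> y" "s * y \<le> r * x" for x b y
  proof -
    obtain k where k: "k \<le> n" "g k = (x, b)" using xb by (auto simp: setL)
    have eq: "g (k + nat (y - b)) = (x, y)" using up[OF k(2), of "nat (y - b)"] y by simp
    have "x \<le> s" using bd[OF k(1)] k(2) by simp
    then have "r * x \<le> s * r" using r by (simp add: mult.commute)
    then have "s * y \<le> s * r" using y(2) by linarith
    then have "y \<le> r" using s by (meson mult_le_cancel_left_pos)
    moreover have "x + y = int (k + nat (y - b))" using inv[of "k + nat (y - b)"] eq by simp
    ultimately have "k + nat (y - b) \<le> n" using \<open>x \<le> s\<close> unfolding n_def by linarith
    then show ?thesis using eq by (metis atMost_iff image_eqI setL)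
  qed
  ultimately have "is_lower_path r s L" unfolding is_lower_path_def by blast
  then show ?thesis ..
qed

lemma is_lower_path_lower_path:
  assumes "0 < r" "0 < s"
  shows "is_lower_path r s (lower_path r s)"
  unfolding lower_path_def
  using is_lower_path_exists[OF assms] is_lower_path_unique[OF _ _ assms(2)] by (metis theI)

text \<open>
  From here on all coordinates are doubled, so that \<open>(i, j)\<close> stands for the point
  \<open>(i / 2, j / 2)\<close>; a tile is represented by its south-west vertex.
  The following set consists of the points of the half-integer lattice on a path: its lattice
  points and the midpoints of its steps.
\<close>
definition half_points :: "point list \<Rightarrow> point set" where
  "half_points L =
     {(2 * x, 2 * y) | x y. (x, y) \<in> set L} \<union>
     {(fst (L ! k) + fst (L ! Suc k), snd (L ! k) + snd (L ! Suc k)) | k. Suc k < length L}"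

definition tile_vertices :: "point \<Rightarrow> point set" where
  "tile_vertices t = (case t of (i, j) \<Rightarrow> {(i, j), (i + 1, j), (i + 1, j + 1), (i, j + 1)})"

definition tile_edges :: "point \<Rightarrow> point set set" where
  "tile_edges t = (case t of (i, j) \<Rightarrow>
     {{(i, j), (i + 1, j)}, {(i + 1, j), (i + 1, j + 1)},
      {(i + 1, j + 1), (i, j + 1)}, {(i, j + 1), (i, j)}})"

definition weakly_above_left :: "point set \<Rightarrow> point \<Rightarrow> bool" where
  "weakly_above_left H v \<longleftrightarrow> (\<exists>h \<in> H. fst v \<le> fst h \<and> snd h \<le> snd v)"

definition tiles_on_path :: "int \<Rightarrow> int \<Rightarrow> point set" where
  "tiles_on_path r s =
     {t. tile_vertices t \<subseteq> {0..2 * s} \<times> {0..2 * r} \<and>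
         (\<forall>v \<in> tile_vertices t. weakly_above_left (half_points (lower_path r s)) v) \<and>
         tile_vertices t \<inter> half_points (lower_path r s) \<noteq> {}}"

text \<open>
  The tiles on the path form a sequence in which each tile lies to the right of or above the
  previous one. The snake graph is the section of this sequence from the tile with south-west vertex
  \<open>(1/2, 0)\<close> to the tile with north-east vertex \<open>(s, r - 1/2)\<close>, cut out here by coordinatewise
  bounds on the south-west vertices.
\<close>
definition snake_tiles :: "int \<Rightarrow> int \<Rightarrow> point set" where
  "snake_tiles r s =
     {(i, j) \<in> tiles_on_path r s. 1 \<le> i \<and> 0 \<le> j \<and> i \<le> 2 * s - 1 \<and> j \<le> 2 * r - 2}"

definition snake_vertices :: "int \<Rightarrow> int \<Rightarrow> point set" where
  "snake_vertices r s = (\<Union>t \<in> snake_tiles r s. tile_vertices t)"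

definition snake_edges :: "int \<Rightarrow> int \<Rightarrow> point set set" where
  "snake_edges r s = (\<Union>t \<in> snake_tiles r s. tile_edges t)"

definition perfect_matching :: "'a set \<Rightarrow> 'a set set \<Rightarrow> 'a set set \<Rightarrow> bool" where
  "perfect_matching V E M \<longleftrightarrow> M \<subseteq> E \<and> (\<forall>v \<in> V. \<exists>!e. e \<in> M \<and> v \<in> e)"

definition snake_m :: "int \<Rightarrow> int \<Rightarrow> nat" where
  "snake_m r s = card {M. perfect_matching (snake_vertices r s) (snake_edges r s) M}"

end

theory Submission
  imports Defs
begin

text \<open>
  Write the lattice path of \<open>r / s\<close> as \<open>E w N\<close>. Adding tiles one at a time shows that the number of
  perfect matchings is \<open>weight w\<close>, the sum of the entries of a product of the symmetric unimodular
  matrices \<open>((1, 1), (1, 2))\<close> for \<open>E\<close> and \<open>((2, 1), (1, 1))\<close> for \<open>N\<close>. This weight makes sense for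
  every word, and the word of \<open>r / s\<close> has the least weight among all words with the same letters:
  a corner of a path that lies too far from the segment can be cut without increasing the weight,
  and the paths that allow no such cut differ from the given one only by passing some of
  the lattice points of the segment on the other side, which does not decrease the weight either. Deleting a
  letter strictly decreases the weight, so deleting an \<open>E\<close> from the word of \<open>p / (q + 1)\<close>, or
  an \<open>N\<close> from the word of \<open>(p + 1) / q\<close>, leaves a word that still weighs at least as much as
  the word of \<open>p / q\<close>.
\<close>

section \<open>Weights of words\<close>

text \<open>
  A word stands for a lattice path, \<open>True\<close> being an east and \<open>False\<close> a north step. Each letter
  contributes two tiles of the snake, so the two maps are the squares of the transfer maps
  \<open>(n, e) \<mapsto> (e, n + e)\<close> and \<open>(n, e) \<mapsto> (n + e, n)\<close> for adding a single tile.
\<close>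
fun step :: "bool \<Rightarrow> int \<times> int \<Rightarrow> int \<times> int" where
  "step True (n, e) = (n + e, n + 2 * e)"
| "step False (n, e) = (2 * n + e, n + e)"

definition vec :: "bool list \<Rightarrow> int \<times> int" where
  "vec w = foldr step w (1, 1)"

definition weight :: "bool list \<Rightarrow> int" where
  "weight w = fst (vec w) + snd (vec w)"

definition inner :: "int \<times> int \<Rightarrow> int \<times> int \<Rightarrow> int" where
  "inner p q = fst p * fst q + snd p * snd q"

text \<open>The change of the linear form \<open>r * x - s * y\<close> along \<open>w\<close>; the
  form vanishes on the segment and is positive below it.\<close>

definition phi :: "int \<Rightarrow> int \<Rightarrow> bool list \<Rightarrow> int" where
  "phi r s w = (\<Sum>b\<leftarrow>w. if b then r else - s)"

lemma vec_Nil [simp]: "vec [] = (1, 1)"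
  and vec_Cons [simp]: "vec (b # w) = step b (vec w)"
  by (simp_all add: vec_def)

lemma phi_simps [simp]:
  "phi r s [] = 0" "phi r s (b # w) = (if b then r else - s) + phi r s w"
  "phi r s (u @ v) = phi r s u + phi r s v" "phi r s (rev w) = phi r s w"
  by (simp_all add: phi_def sum_list_rev flip: rev_map)

lemma phi_count_list: "phi r s w = r * int (count_list w True) - s * int (count_list w False)"
  by (induction w) (auto simp: algebra_simps)

lemma vec_pos: "0 < fst (vec w) \<and> 0 < snd (vec w)"
proof (induction w)
  case (Cons b w)
  then show ?case by (cases "vec w"; cases b) auto
qed simp

lemma inner_step: "inner (step b p) q = inner p (step b q)"
  by (cases p; cases q; cases b) (auto simp: inner_def algebra_simps)

lemma inner_foldr_step: "inner (foldr step (rev u) p) q = inner p (foldr step u q)"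
  by (induction u arbitrary: p) (auto simp: inner_step)

text \<open>Both letters act by symmetric matrices, so \<open>u\<close> moves across the inner
  product in reverse order.\<close>

lemma weight_append: "weight (u @ v) = inner (vec (rev u)) (vec v)"
  using inner_foldr_step[of u "(1, 1)" "vec v"] by (simp add: weight_def vec_def inner_def)

lemma weight_rev: "weight (rev w) = weight w"
  using weight_append[of w "[]"] by (simp add: weight_def inner_def)

lemma weight_insert_letter: "weight (u @ v) < weight (u @ b # v)"
proof -
  obtain n e where y: "vec v = (n, e)" by fastforce
  obtain a c where x: "vec (rev u) = (a, c)" by fastforce
  have "0 < n" "0 < e" "0 < a" "0 < c" using vec_pos[of v] vec_pos[of "rev u"] x y by auto
  then have "0 < a * n" "0 < a * e" "0 < c * n" "0 < c * e" by simp_all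
  then show ?thesis
    by (cases b) (simp_all add: weight_append x y inner_def algebra_simps)
qed

text \<open>The commutator of the two matrices is twice a rotation by a right angle, so exchanging
  the steps of a corner compares the slopes of \<open>vec (rev u)\<close> and
  \<open>vec v\<close>.\<close>

lemma weight_swap:
  "weight (u @ True # False # v) - weight (u @ False # True # v) =
    2 * (snd (vec (rev u)) * fst (vec v) - fst (vec (rev u)) * snd (vec v))"
  by (cases "vec v"; cases "vec (rev u)") (simp add: weight_append inner_def algebra_simps)

lemma vec_map_Not: "vec (map Not w) = prod.swap (vec w)"
proof (induction w)
  case (Cons b w)
  then show ?case by (cases "vec w"; cases b) auto
qed simp

lemma weight_map_Not: "weight (map Not w) = weight w"
  by (simp add: weight_def vec_map_Not)

text \<open>
  The slope \<open>snd / fst\<close> of \<open>vec w\<close> is monotone in the lexicographic order in which the end of the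
  word ranks strictly between the letters \<open>False\<close> and \<open>True\<close>.
\<close>
lemma slope_less_imp_first_difference:
  assumes "snd (vec a) * fst (vec b) < fst (vec a) * snd (vec b)"
  obtains (letters) m a' b' where "a = m @ False # a'" "b = m @ True # b'"
    | (right_end) a' where "a = b @ False # a'"
    | (left_end) b' where "b = a @ True # b'"
proof -
  have "(\<exists>m a' b'. a = m @ False # a' \<and> b = m @ True # b') \<or> (\<exists>a'. a = b @ False # a') \<or>
      (\<exists>b'. b = a @ True # b')"
    using assms
  proof (induction a arbitrary: b)
    case Nil
    then show ?case
    proof (cases b)
      case (Cons y b')
      then show ?thesis using Nil vec_pos[of b'] by (cases y; cases "vec b'") auto
    qed simp
  next
    case (Cons x a)
    obtain n e where a: "vec a = (n, e)" by fastforce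
    have pos: "0 < n" "0 < e" using vec_pos[of a] a by auto
    show ?case
    proof (cases b)
      case Nil
      then show ?thesis using Cons.prems a pos by (cases x) auto
    next
      case b: (Cons y b')
      obtain n' e' where b': "vec b' = (n', e')" by fastforce
      have pos': "0 < n'" "0 < e'" using vec_pos[of b'] b' by auto
      have prods: "0 < n * n'" "0 < n * e'" "0 < e * n'" "0 < e * e'" using pos pos' by simp_all
      consider "x = y" | "x" "\<not> y" | "\<not> x" "y" by blast
      then show ?thesis
      proof cases
        case 1
        \<comment> \<open>Letters have determinant one, so a common first letter cancels.\<close>
        have "snd (vec a) * fst (vec b') < fst (vec a) * snd (vec b')"
          using Cons.prems 1 b a b' by (cases y) (auto simp: algebra_simps)
        from Cons.IH[OF this] show ?thesis
          unfolding b 1 by (metis append_Cons)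
      next
        case 2
        \<comment> \<open>Impossible: \<open>step True\<close> yields slopes above 1 and
          \<open>step False\<close> slopes below 1.\<close>
        then show ?thesis using Cons.prems b a b' prods by (simp add: algebra_simps)
      next
        case 3
        then show ?thesis using b by (metis append_Nil)
      qed
    qed
  qed
  then show thesis using letters right_end left_end by blast
qed

section \<open>Cutting corners far from the segment\<close>

text \<open>Termination measure for cutting corners: the total distance of the values of the linear
  form to the middle \<open>(r + s) / 2\<close> of the band, doubled to stay integral.\<close>

fun deviation :: "int \<Rightarrow> int \<Rightarrow> int \<Rightarrow> bool list \<Rightarrow> nat" where
  "deviation r s c [] = 0"
| "deviation r s c (b # w) =
     nat \<bar>2 * c - (r + s)\<bar> + deviation r s (c + (if b then r else - s)) w"

lemma deviation_append:
  "deviation r s c (u @ v) = deviation r s c u + deviation r s (c + phi r s u) v"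
  by (induction u arbitrary: c) (auto simp: add.assoc)

lemma phi_map_Not: "phi s r (map Not w) = - phi r s w"
  by (induction w) auto

lemma deviation_map_Not:
  "deviation s r (r + s - c) (map Not w) = deviation r s c w"
proof (induction w arbitrary: c)
  case (Cons b w)
  have "nat \<bar>2 * (r + s - c) - (s + r)\<bar> = nat \<bar>2 * c - (r + s)\<bar>" by simp
  moreover have "r + s - c + (if \<not> b then s else - r) = r + s - (c + (if b then r else - s))"
    by auto
  ultimately show ?case using Cons by (simp only: list.map deviation.simps)
qed simp

text \<open>The split is at the last place where the partial sum is maximal; being the last makes
  the later drop strict.\<close>

lemma last_maximum_prefix:
  obtains p v where "w = p @ v"
    and "\<And>u x. w = u @ x \<Longrightarrow> phi r s u \<le> phi r s p"
    and "\<And>x y. v = x @ y \<Longrightarrow> x \<noteq> [] \<Longrightarrow> phi r s x < 0"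
proof -
  define f where "f k = phi r s (take k w)" for k
  define D where "D = Max (f ` {..length w})"
  have Dge: "f k \<le> D" if "k \<le> length w" for k using that by (simp add: D_def)
  have "D \<in> f ` {..length w}" unfolding D_def by (rule Max_in) auto
  then have ne: "{k. k \<le> length w \<and> f k = D} \<noteq> {}" by auto
  define k where "k = Max {k. k \<le> length w \<and> f k = D}"
  have "k \<in> {k. k \<le> length w \<and> f k = D}" unfolding k_def by (rule Max_in) (use ne in auto)
  then have k: "k \<le> length w" "f k = D" by auto
  have klast: "j \<le> k" if "j \<le> length w" "f j = D" for j
    unfolding k_def by (rule Max_ge) (use that in auto)
  show thesis
  proof
    show "w = take k w @ drop k w" by simp
    show "phi r s u \<le> phi r s (take k w)" if "w = u @ x" for u x
      using Dge[of "length u"] that k(2) by (simp add: f_def)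
    show "phi r s x < 0" if xy: "drop k w = x @ y" and "x \<noteq> []" for x y
    proof -
      have w: "w = take k w @ x @ y" by (metis append_take_drop_id xy)
      have le: "k + length x \<le> length w" using arg_cong[OF w, of length] k(1) by simp
      have "take (k + length x) w = take k w @ x"
        by (metis take_add append_eq_conv_conj xy)
      then have "f (k + length x) = D + phi r s x" using k by (simp add: f_def)
      moreover have "f (k + length x) \<noteq> D" using klast[OF le] \<open>x \<noteq> []\<close> by auto
      ultimately show ?thesis using Dge[OF le] by simp
    qed
  qed
qed

text \<open>
  The value \<open>r + phi r s u\<close> is the linear form \<open>r * x - s * y\<close> at the point of the path reached after
  an initial east step followed by \<open>u\<close>. At the last point where it is maximal the path turns from
  east to north. If cutting this corner increased the weight, then, walking away from the corner
  in both directions, the first difference would be a north step backwards against an east step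
  forwards, and one of the two points reached would violate the choice of the corner.
\<close>
lemma cut_high_corner:
  assumes r: "0 < r" and s: "0 < s" and tot: "phi r s w = s - r"
    and high: "w = p0 @ v0" "s < phi r s p0"
  obtains w' where "weight w' \<le> weight w" "deviation r s r w' < deviation r s r w"
    "count_list w' = count_list w"
proof -
  obtain p v where w: "w = p @ v" and mx: "\<And>u x. w = u @ x \<Longrightarrow> phi r s u \<le> phi r s p"
    and lst: "\<And>x y. v = x @ y \<Longrightarrow> x \<noteq> [] \<Longrightarrow> phi r s x < 0"
    using last_maximum_prefix[of w r s] by blast
  have D: "s < phi r s p" using mx[OF high(1)] high(2) by simp
  have "p \<noteq> []" using D s by auto
  then obtain u b where p: "p = u @ [b]" by (metis append_butlast_last_id)
  have b: "b" using mx[of u "[b] @ v"] w p s by (auto split: if_splits)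
  have "v \<noteq> []" using D tot w r by auto
  then obtain d v' where v: "v = d # v'" by (cases v) auto
  have d: "\<not> d" using lst[of "[d]" v'] v r by (auto split: if_splits)
  have W: "w = u @ True # False # v'" using w p b v d by simp
  have P: "phi r s p = phi r s u + r" using p b by simp
  define w' where "w' = u @ False # True # v'"
  have "\<not> snd (vec (rev u)) * fst (vec v') < fst (vec (rev u)) * snd (vec v')"
  proof
    assume "snd (vec (rev u)) * fst (vec v') < fst (vec (rev u)) * snd (vec v')"
    then show False
    proof (cases rule: slope_less_imp_first_difference)
      \<comment> \<open>Maximality gives \<open>phi r s m \<ge> s - r\<close>, the strict drop after
        the corner gives \<open>phi r s m < s - r\<close>.\<close>
      case (letters m a' b')
      have u: "u = rev a' @ False # rev m" using letters(1) by (simp add: rev_swap)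
      have "phi r s (rev a') \<le> phi r s p" using mx[of "rev a'"] w p u by simp
      moreover have "phi r s (False # m @ [True]) < 0" using lst[of "False # m @ [True]" b'] v d letters by simp
      ultimately show False using P u by simp
    next
      \<comment> \<open>Maximality gives \<open>phi r s v' \<ge> s - r\<close>; with the total this
        forces \<open>phi r s p \<le> s\<close>.\<close>
      case (right_end a')
      have u: "u = rev a' @ False # rev v'" using right_end by (simp add: rev_swap)
      have "phi r s (rev a') \<le> phi r s p" using mx[of "rev a'"] w p u by simp
      then show False using P u tot W D by simp
    next
      case (left_end b')
      have "phi r s (False # rev u @ [True]) < 0" using lst[of "False # rev u @ [True]" b'] v d left_end by simp
      then show False using P D by simp
    qed
  qed
  then have "weight w' \<le> weight w" using weight_swap[of u v'] W w'_def by simp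
  moreover have "deviation r s r w' < deviation r s r w"
  proof -
    \<comment> \<open>Only one point moves: its value exceeds \<open>r + s\<close> and drops by
      \<open>r + s\<close>, hence comes closer to the middle.\<close>
    have "\<bar>2 * (r + phi r s u - s) - (r + s)\<bar> < \<bar>2 * (r + phi r s u + r) - (r + s)\<bar>"
      using P D r s by arith
    then have "nat \<bar>2 * (r + phi r s u - s) - (r + s)\<bar> < nat \<bar>2 * (r + phi r s u + r) - (r + s)\<bar>"
      by linarith
    moreover have "r + phi r s u - s + r = r + phi r s u + r - s" by simp
    ultimately show ?thesis
      by (simp only: W w'_def deviation_append deviation.simps if_True if_False
          diff_conv_add_uminus[symmetric] add_less_cancel_left add_less_cancel_right
          add.assoc[symmetric])
  qed
  moreover have "count_list w' = count_list w" by (simp add: W w'_def fun_eq_iff)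
  ultimately show thesis using that by blast
qed

text \<open>The bound \<open>r + s\<close> is attained by paths that avoid a lattice point of the
  segment on its lower right.\<close>

definition in_band :: "int \<Rightarrow> int \<Rightarrow> int \<Rightarrow> bool list \<Rightarrow> bool" where
  "in_band r s c w \<longleftrightarrow> (\<forall>u v. w = u @ v \<longrightarrow> 0 \<le> c + phi r s u \<and> c + phi r s u \<le> r + s)"

lemma count_list_map_Not: "count_list (map Not w) b = count_list w (\<not> b)"
  by (induction w) auto

text \<open>A word leaving the band above has a corner to cut; one leaving it below is first
  reflected in the diagonal. Each cut decreases \<open>deviation\<close>.\<close>

lemma exists_lighter_in_band:
  assumes r: "0 < r" and s: "0 < s" and tot: "phi r s w = s - r"
  obtains w' where "weight w' \<le> weight w" "count_list w' = count_list w" "in_band r s r w'"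
proof -
  have "\<exists>w'. weight w' \<le> weight w \<and> count_list w' = count_list w \<and> in_band r s r w'"
    using tot
  proof (induction "deviation r s r w" arbitrary: w rule: less_induct)
    case less
    have improve: ?case
      if x: "weight x \<le> weight w" "deviation r s r x < deviation r s r w"
        "count_list x = count_list w" for x
    proof -
      have "phi r s x = s - r" using less.prems x(3) by (simp add: phi_count_list)
      then show ?thesis using less.hyps[OF x(2)] x by (metis order_trans)
    qed
    show ?case
    proof (cases "in_band r s r w")
      case False
      then obtain u v where w: "w = u @ v" and "r + phi r s u < 0 \<or> s < phi r s u"
        by (force simp: in_band_def)
      then show ?thesis
      proof (elim disjE)
        assume "s < phi r s u"
        then show ?thesis using cut_high_corner[OF r s less.prems w] improve by metis
      next
        assume low: "r + phi r s u < 0"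
        have "phi s r (map Not w) = r - s" using less.prems by (simp add: phi_map_Not)
        moreover have "map Not w = map Not u @ map Not v" using w by simp
        moreover have "r < phi s r (map Not u)" using low by (simp add: phi_map_Not)
        ultimately obtain x where x: "weight x \<le> weight (map Not w)"
          "deviation s r s x < deviation s r s (map Not w)" "count_list x = count_list (map Not w)"
          using cut_high_corner[OF s r] by metis
        have "deviation r s r (map Not x) = deviation s r s x" for x
          using deviation_map_Not[of r s s x] by simp
        moreover have "deviation s r s (map Not w) = deviation r s r w"
          using deviation_map_Not[of s r r w] by simp
        ultimately show ?thesis using improve[of "map Not x"] x
          by (simp add: weight_map_Not count_list_map_Not fun_eq_iff)
      qed
    qed auto
  qed
  then show thesis using that by blast
qed

section \<open>Decomposition of paths in the band\<close>

lemma in_band_append: "in_band r s c (u @ v) \<Longrightarrow> in_band r s c u \<and> in_band r s (c + phi r s u) v"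
  unfolding in_band_def by (metis add.assoc append.assoc phi_simps(3))

lemma in_band_start: "in_band r s c w \<Longrightarrow> 0 \<le> c \<and> c \<le> r + s"
  unfolding in_band_def by (metis add.right_neutral append_Nil phi_simps(1))

lemma in_band_Cons: "in_band r s c (b # w) \<Longrightarrow> in_band r s (c + (if b then r else - s)) w"
  using in_band_append[of r s c "[b]" w] by simp

text \<open>Inside the band only the value \<open>s\<close> leaves a choice of the next step, so
  words are cut at their visits to \<open>s\<close>.\<close>

definition first_passage :: "int \<Rightarrow> int \<Rightarrow> int \<Rightarrow> bool list \<Rightarrow> bool" where
  "first_passage r s c w \<longleftrightarrow> in_band r s c w \<and> c + phi r s w = s \<and>
     (\<forall>u v. w = u @ v \<longrightarrow> v \<noteq> [] \<longrightarrow> c + phi r s u \<noteq> s)"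

text \<open>An east step needs \<open>c + r \<le> r + s\<close> and a north step needs
  \<open>0 \<le> c - s\<close>, so for \<open>c \<noteq> s\<close> the letter is forced.\<close>

lemma first_passage_Cons:
  assumes "first_passage r s c (b # w)"
  shows "c \<noteq> s" "b \<longleftrightarrow> c < s" "first_passage r s (c + (if b then r else - s)) w"
proof -
  have band: "in_band r s c (b # w)" and e: "c + phi r s (b # w) = s"
    and av: "\<And>u v. b # w = u @ v \<Longrightarrow> v \<noteq> [] \<Longrightarrow> c + phi r s u \<noteq> s"
    using assms by (auto simp: first_passage_def)
  show "c \<noteq> s" using av[of "[]" "b # w"] by simp
  then show "b \<longleftrightarrow> c < s" using in_band_start[OF in_band_Cons[OF band]] by (auto split: if_splits)
  have "c + (if b then r else - s) + phi r s u \<noteq> s" if "w = u @ v" "v \<noteq> []" for u v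
    using av[of "b # u" v] that by (simp add: add.assoc)
  then show "first_passage r s (c + (if b then r else - s)) w"
    using e in_band_Cons[OF band] by (simp add: first_passage_def add.assoc)
qed

lemma first_passage_unique:
  "first_passage r s c v \<Longrightarrow> first_passage r s c w \<Longrightarrow> v = w"
proof (induction v arbitrary: c w)
  case Nil
  then have "c = s" by (simp add: first_passage_def)
  then show ?case using Nil.prems(2) first_passage_Cons(1) by (metis list.exhaust)
next
  case (Cons b v)
  show ?case
  proof (cases w)
    case Nil
    then have "c = s" using Cons.prems by (simp add: first_passage_def)
    then show ?thesis using first_passage_Cons(1)[OF Cons.prems(1)] by simp
  next
    case w: (Cons d w')
    have "b = d"
      using first_passage_Cons(2)[OF Cons.prems(1)] first_passage_Cons(2) Cons.prems(2) w by blast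
    then show ?thesis
      using Cons.IH first_passage_Cons(3)[OF Cons.prems(1)] first_passage_Cons(3) Cons.prems(2) w by blast
  qed
qed

lemma first_passage_suffix:
  "first_passage r s c (u @ v) \<Longrightarrow> first_passage r s (c + phi r s u) v"
  unfolding first_passage_def using in_band_append
  by (metis add.assoc append.assoc phi_simps(3))

text \<open>A half-turn sends the value \<open>c\<close> to \<open>r + s - c\<close> and preserves
  the band; read backwards, the path again leads from \<open>r\<close> to \<open>s\<close>, so
  uniqueness applies.\<close>

lemma first_passage_palindrome:
  assumes w: "first_passage r s r w"
  shows "rev w = w"
proof (rule first_passage_unique[of r s r])
  have tot: "r + phi r s w = s" using w by (simp add: first_passage_def)
  have "in_band r s r (rev w)"
    unfolding in_band_def
  proof (intro allI impI)
    fix u v assume "rev w = u @ v"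
    then have "w = rev v @ rev u" by (metis rev_append rev_rev_ident)
    moreover from this have "0 \<le> r + phi r s (rev v) \<and> r + phi r s (rev v) \<le> r + s"
      using w unfolding first_passage_def in_band_def by blast
    ultimately show "0 \<le> r + phi r s u \<and> r + phi r s u \<le> r + s" using tot by simp
  qed
  moreover have "r + phi r s u \<noteq> s" if uv: "rev w = u @ v" "v \<noteq> []" for u v
  proof
    assume *: "r + phi r s u = s"
    have wv: "w = rev v @ rev u" using uv by (metis rev_append rev_rev_ident)
    \<comment> \<open>An early visit to \<open>s\<close> makes \<open>rev v\<close> return to
      \<open>r\<close>; dropping it leaves a shorter first passage, against uniqueness.\<close>
    then have "phi r s (rev v) = 0" using * tot by simp
    then have "first_passage r s r (rev u)" using first_passage_suffix[of r s r "rev v" "rev u"] w wv by simp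
    then have "rev u = w" using first_passage_unique w by blast
    then show False using wv uv(2) by simp
  qed
  ultimately show "first_passage r s r (rev w)" using tot by (simp add: first_passage_def)
qed (fact w)

lemma first_passage_exists:
  "in_band r s c w \<Longrightarrow> c + phi r s w = s \<Longrightarrow> \<exists>u v. w = u @ v \<and> first_passage r s c u"
proof (induction w rule: length_induct)
  case (1 w)
  show ?case
  proof (cases "first_passage r s c w")
    case False
    then obtain u v where "w = u @ v" "v \<noteq> []" "c + phi r s u = s"
      using 1 by (auto simp: first_passage_def)
    then show ?thesis using 1 in_band_append
      by (metis append.assoc length_append length_greater_0_conv less_add_same_cancel1)
  qed auto
qed

text \<open>Copies of the forced stretch \<open>m\<close> joined by corners: \<open>False\<close>
  runs through a lattice point of the segment, \<open>True\<close> avoids it on the lower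
  right.\<close>

fun blocks :: "bool list \<Rightarrow> bool list \<Rightarrow> bool list" where
  "blocks m [] = m"
| "blocks m (b # bs) = m @ b # (\<not> b) # blocks m bs"

text \<open>From \<open>s\<close> a step leads to \<open>0\<close> or \<open>r + s\<close>; the step
  after it is forced and returns to \<open>r\<close>, where the next copy of \<open>m\<close>
  begins.\<close>

lemma in_band_blocks:
  assumes r: "0 < r" and s: "0 < s" and "first_passage r s r m"
    and "in_band r s r w" "phi r s w = s - r"
  shows "\<exists>bs. w = blocks m bs"
  using assms(4,5)
proof (induction w rule: length_induct)
  case (1 w)
  obtain u v where w: "w = u @ v" and "first_passage r s r u"
    using first_passage_exists[of r s r w] 1 by auto
  with assms(3) have u: "u = m" using first_passage_unique by blast
  have m: "r + phi r s m = s" using assms(3) by (simp add: first_passage_def)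
  have band: "in_band r s s v" using in_band_append[of r s r u v] 1 w u m by auto
  have pv: "phi r s v = 0" using 1 w u m by simp
  show ?case
  proof (cases v)
    case Nil
    then show ?thesis using w u by (metis append_Nil2 blocks.simps(1))
  next
    case v: (Cons b v1)
    have "v1 \<noteq> []" using pv v r s by (auto split: if_splits)
    then obtain d v2 where v1: "v1 = d # v2" by (cases v1) auto
    have band2: "in_band r s (s + (if b then r else - s) + (if d then r else - s)) v2"
      using band v v1 in_band_Cons by blast
    have d: "d = (\<not> b)" using in_band_start[OF band2] r s by (auto split: if_splits)
    have "in_band r s r v2" using band2 d by (cases b) auto
    moreover have "phi r s v2 = s - r" using pv v v1 d by (cases b) auto
    moreover have "length v2 < length w" using w v v1 by simp
    ultimately obtain bs where "v2 = blocks m bs" using 1 by blast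
    then have "w = blocks m (b # bs)" using w u v v1 d by simp
    then show ?thesis by blast
  qed
qed

lemma length_blocks: "length (blocks m bs) = length m + length bs * (length m + 2)"
  by (induction bs) auto

section \<open>Weights of block words\<close>

definition sgn_of :: "bool \<Rightarrow> int" where "sgn_of b = (if b then - 1 else 1)"

text \<open>This determinant completes the weight to a pair that obeys a linear recursion when a
  block is prepended.\<close>

definition skew :: "bool list \<Rightarrow> bool list \<Rightarrow> int" where
  "skew m w = fst (vec m) * snd (vec w) - snd (vec m) * fst (vec w)"

lemma foldr_step_cross:
  "fst (foldr step m p) * snd (foldr step m q) - snd (foldr step m p) * fst (foldr step m q) =
     fst p * snd q - snd p * fst q"
proof (induction m)
  case (Cons b m)
  then show ?case
    by (cases "foldr step m p"; cases "foldr step m q"; cases b) (auto simp: algebra_simps)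
qed simp

text \<open>
  The matrices of the two corners are \<open>3 * U - J\<close> and \<open>3 * U + J\<close>, with \<open>U\<close> the all-ones
  matrix and \<open>J\<close> the rotation by a right angle, and \<open>Q * J * Q = J\<close> for the symmetric unimodular
  matrix \<open>Q\<close> of a palindrome; this turns the weights of words made of blocks into a continuant.
\<close>
lemma weight_blocks_Cons:
  assumes "rev m = m"
  shows "weight (blocks m (b # bs)) =
      3 * weight m * weight (blocks m bs) + sgn_of b * skew m (blocks m bs)"
    and "skew m (blocks m (b # bs)) = - sgn_of b * weight (blocks m bs)"
proof -
  obtain n e where y: "vec (blocks m bs) = (n, e)" by fastforce
  obtain a c where x: "vec m = (a, c)" by fastforce
  show "weight (blocks m (b # bs)) =
      3 * weight m * weight (blocks m bs) + sgn_of b * skew m (blocks m bs)"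
    using assms
    by (cases b) (simp_all add: weight_append weight_def[of m] weight_def[of "blocks m bs"] x y
        inner_def skew_def sgn_of_def algebra_simps)
  have "skew m (m @ v) = snd (vec v) - fst (vec v)" for v
    using foldr_step_cross[of m "(1, 1)" "vec v"] by (simp add: skew_def vec_def)
  then show "skew m (blocks m (b # bs)) = - sgn_of b * weight (blocks m bs)"
    by (cases b) (simp_all add: y weight_def sgn_of_def)
qed

lemma weight_pos: "0 < weight w"
  using vec_pos[of w] by (simp add: weight_def)

text \<open>By the recursion the new skew is the old weight up to sign, and constant corners always
  give it the sign that lowers the next weight. The induction also needs that they minimize the
  weight minus the absolute skew.\<close>

lemma weight_blocks_ge_replicate:
  assumes "rev m = m"
  shows "weight (blocks m (replicate (length bs) False)) \<le> weight (blocks m bs)"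
proof -
  let ?c = "\<lambda>bs. blocks m (replicate (length bs) False)"
  have m: "1 \<le> weight m" using weight_pos[of m] by simp
  have "weight (?c bs) \<le> weight (blocks m bs) \<and> skew m (?c bs) \<le> 0 \<and>
      0 \<le> weight (?c bs) + skew m (?c bs) \<and>
      weight (?c bs) + skew m (?c bs) \<le> weight (blocks m bs) - \<bar>skew m (blocks m bs)\<bar>"
  proof (induction bs)
    case Nil
    then show ?case using weight_pos[of m] by (simp add: skew_def)
  next
    case (Cons b bs)
    let ?W = "weight (blocks m bs)" and ?W' = "weight (?c bs)"
    have pos: "0 < ?W'" by (rule weight_pos)
    define A where "A = weight m * ?W'"
    define B where "B = weight m * ?W"
    \<comment> \<open>The new weight minus absolute skew is at least
      \<open>(3 * weight m - 2) * ?W\<close> plus the old such difference, with equality for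
      constant corners.\<close>
    have "(3 * weight m - 2) * ?W' \<le> (3 * weight m - 2) * ?W"
      using Cons m by (intro mult_left_mono) auto
    then have AB: "3 * A - 2 * ?W' \<le> 3 * B - 2 * ?W"
      by (simp add: A_def B_def algebra_simps)
    have "1 * ?W' \<le> weight m * ?W'" using m pos by (intro mult_right_mono) auto
    then have A: "?W' \<le> A" by (simp add: A_def)
    have "weight (?c (b # bs)) = 3 * A + skew m (?c bs)" "skew m (?c (b # bs)) = - ?W'"
      using weight_blocks_Cons[OF assms, of False "replicate (length bs) False"]
      by (simp_all add: A_def sgn_of_def)
    moreover have "weight (blocks m (b # bs)) = 3 * B + sgn_of b * skew m (blocks m bs)"
      "\<bar>skew m (blocks m (b # bs))\<bar> = ?W"
      using weight_blocks_Cons[OF assms, of b bs] weight_pos[of "blocks m bs"]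
      by (simp_all add: B_def sgn_of_def)
    moreover have "- \<bar>skew m (blocks m bs)\<bar> \<le> sgn_of b * skew m (blocks m bs)"
      by (auto simp: sgn_of_def)
    ultimately show ?case using Cons pos AB A by linarith
  qed
  then show ?thesis by simp
qed

section \<open>Minimality of the word of the lattice path\<close>

text \<open>The lighter band word obtained from \<open>w\<close> and the word \<open>x\<close> are
  built from the same \<open>m\<close> with equally many corners; those of \<open>x\<close> are all
  \<open>False\<close>, the lightest choice.\<close>

lemma christoffel_minimal:
  assumes r: "0 < r" and s: "0 < s"
    and low: "\<And>u v. x = u @ v \<Longrightarrow> 0 \<le> r + phi r s u \<and> phi r s u < s"
    and x: "phi r s x = s - r" and cnt: "count_list w = count_list x"
  shows "weight x \<le> weight w"
proof -
  have "phi r s w = s - r" using x cnt by (simp add: phi_count_list)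
  then obtain w' where w': "weight w' \<le> weight w" "count_list w' = count_list w" "in_band r s r w'"
    using exists_lighter_in_band[OF r s] by blast
  have pw': "phi r s w' = s - r" using x cnt w'(2) by (simp add: phi_count_list)
  have bx: "in_band r s r x" unfolding in_band_def using low by fastforce
  obtain m where m: "first_passage r s r m"
    using first_passage_exists[OF bx] x by auto
  obtain bs where bs: "w' = blocks m bs" using in_band_blocks[OF r s m w'(3) pw'] by blast
  obtain cs where cs: "x = blocks m cs" using in_band_blocks[OF r s m bx x] by blast
  have len: "length w' = length x"
  proof -
    have "length u = count_list u True + count_list u False" for u by (induction u) auto
    then show ?thesis using w'(2) cnt by simp
  qed
  have "length bs * (length m + 2) = length cs * (length m + 2)"
    using len by (simp add: bs cs length_blocks)
  then have "length bs = length cs"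
    by (metis mult_right_cancel add_is_0 zero_neq_numeral)
  moreover have "cs = replicate (length cs) False"
  proof -
    have pm: "phi r s m = s - r" using m by (simp add: first_passage_def)
    have "\<forall>b\<in>set cs. \<not> b" if "\<And>u v. blocks m cs = u @ v \<Longrightarrow> phi r s u < s" for cs
      using that
    proof (induction cs)
      case (Cons b cs)
      \<comment> \<open>An east step after \<open>m\<close> would bring the sum to \<open>s\<close>,
        which the strict bound excludes.\<close>
      have "\<not> b" using Cons.prems[of "m @ [b]" "(\<not> b) # blocks m cs"] pm by auto
      moreover have "phi r s u < s" if "blocks m cs = u @ v" for u v
        using Cons.prems[of "m @ b # (\<not> b) # u" v] that pm by (auto split: if_splits)
      ultimately show ?case using Cons.IH by auto
    qed simp
    then show ?thesis using low cs by (metis (full_types) replicate_eqI)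
  qed
  ultimately have "weight x \<le> weight w'"
    using weight_blocks_ge_replicate[OF first_passage_palindrome[OF m], of bs] bs cs by metis
  then show ?thesis using w'(1) by simp
qed

section \<open>Perfect matchings of snakes\<close>

lemma perfect_matchingD:
  "perfect_matching V E M \<Longrightarrow> v \<in> V \<Longrightarrow> v \<in> e \<Longrightarrow> v \<in> e' \<Longrightarrow> e \<in> M \<Longrightarrow> e' \<in> M \<Longrightarrow> e = e'"
  unfolding perfect_matching_def by blast

text \<open>
  Gluing the path \<open>c - a - b - d\<close> to an edge \<open>{c, d}\<close>: a perfect matching of the larger graph uses
  either \<open>{a, b}\<close>, or both \<open>{a, c}\<close> and \<open>{b, d}\<close>, which then stand in for \<open>{c, d}\<close>.
\<close>
locale glued_square =
  fixes V :: "'a set" and E :: "'a set set" and a b c d :: 'a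
  assumes edges: "\<Union>E \<subseteq> V" and cd: "c \<in> V" "d \<in> V" "c \<noteq> d" "{c, d} \<in> E"
    and ab: "a \<notin> V" "b \<notin> V" "a \<noteq> b"
begin

abbreviation "V' \<equiv> insert a (insert b V)"
abbreviation "E' \<equiv> insert {a, b} (insert {a, c} (insert {b, d} E))"

lemma edge_at_a: "e \<in> E' \<Longrightarrow> a \<in> e \<Longrightarrow> e = {a, b} \<or> e = {a, c}"
  using edges cd ab by auto

lemma edge_at_b: "e \<in> E' \<Longrightarrow> b \<in> e \<Longrightarrow> e = {a, b} \<or> e = {b, d}"
  using edges cd ab by auto

lemma new_edges_distinct: "{a, b} \<noteq> {a, c}" "{a, b} \<noteq> {b, d}" "{a, c} \<noteq> {b, d}"
  "{a, b} \<notin> E" "{a, c} \<notin> E" "{b, d} \<notin> E" "{c, d} \<noteq> {a, b}" "{c, d} \<noteq> {a, c}" "{c, d} \<noteq> {b, d}"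
  using edges cd ab by (auto simp: doubleton_eq_iff)

lemma matching_cases:
  assumes M: "perfect_matching V' E' M"
  shows "{a, b} \<in> M \<and> {a, c} \<notin> M \<and> {b, d} \<notin> M \<or> {a, b} \<notin> M \<and> {a, c} \<in> M \<and> {b, d} \<in> M"
proof -
  have sub: "M \<subseteq> E'" using M by (simp add: perfect_matching_def)
  obtain e where e: "e \<in> M" "a \<in> e" using M by (auto simp: perfect_matching_def)
  obtain f where f: "f \<in> M" "b \<in> f" using M by (auto simp: perfect_matching_def)
  have e': "e = {a, b} \<or> e = {a, c}" by (rule edge_at_a[OF subsetD[OF sub e(1)] e(2)])
  have f': "f = {a, b} \<or> f = {b, d}" by (rule edge_at_b[OF subsetD[OF sub f(1)] f(2)])
  have 1: "\<not> ({a, b} \<in> M \<and> {a, c} \<in> M)"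
    using perfect_matchingD[OF M, of a "{a, b}" "{a, c}"] new_edges_distinct(1) by blast
  have 2: "\<not> ({a, b} \<in> M \<and> {b, d} \<in> M)"
    using perfect_matchingD[OF M, of b "{a, b}" "{b, d}"] new_edges_distinct(2) by blast
  show ?thesis using e(1) e' f(1) f' 1 2 by metis
qed

lemma matchings_with_outer_edge:
  "{M. perfect_matching V' E' M \<and> {a, b} \<in> M} = insert {a, b} ` {M. perfect_matching V E M}"
proof (intro equalityI subsetI)
  fix M assume "M \<in> {M. perfect_matching V' E' M \<and> {a, b} \<in> M}"
  then have M: "perfect_matching V' E' M" "{a, b} \<in> M" by auto
  have not: "{a, c} \<notin> M" "{b, d} \<notin> M" using matching_cases[OF M(1)] M(2) by auto
  have "perfect_matching V E (M - {{a, b}})"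
    unfolding perfect_matching_def
  proof (intro conjI ballI)
    show "M - {{a, b}} \<subseteq> E" using M(1) not by (auto simp: perfect_matching_def)
    fix v assume v: "v \<in> V"
    then have "v \<notin> {a, b}" using ab by auto
    moreover have "\<exists>!e. e \<in> M \<and> v \<in> e" using M(1) v by (simp add: perfect_matching_def)
    ultimately show "\<exists>!e. e \<in> M - {{a, b}} \<and> v \<in> e" by blast
  qed
  moreover have "M = insert {a, b} (M - {{a, b}})" using M(2) by auto
  ultimately show "M \<in> insert {a, b} ` {M. perfect_matching V E M}" by blast
next
  fix M assume "M \<in> insert {a, b} ` {M. perfect_matching V E M}"
  then obtain N where N: "perfect_matching V E N" and M: "M = insert {a, b} N" by blast
  have sub: "N \<subseteq> E" using N by (simp add: perfect_matching_def)
  have "\<exists>!e. e \<in> M \<and> v \<in> e" if v: "v \<in> V'" for v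
  proof (cases "v \<in> V")
    case True
    then have "v \<notin> {a, b}" using ab by auto
    moreover have "\<exists>!e. e \<in> N \<and> v \<in> e" using N True by (simp add: perfect_matching_def)
    ultimately show ?thesis unfolding M by blast
  next
    case False
    then have "v \<in> {a, b}" using v by auto
    moreover have "v \<notin> e" if "e \<in> N" for e using that sub edges False by auto
    ultimately show ?thesis unfolding M by (intro ex1I[of _ "{a, b}"]) auto
  qed
  moreover have "M \<subseteq> E'" using sub unfolding M by blast
  moreover have "{a, b} \<in> M" unfolding M by blast
  ultimately show "M \<in> {M. perfect_matching V' E' M \<and> {a, b} \<in> M}"
    unfolding perfect_matching_def by blast
qed

lemma matchings_with_side_edge:
  "{M. perfect_matching V' E' M \<and> {b, d} \<in> M} =
    (\<lambda>M. insert {a, c} (insert {b, d} (M - {{c, d}}))) ` {M. perfect_matching V E M \<and> {c, d} \<in> M}"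
    (is "?L = ?f ` ?R")
proof (intro equalityI subsetI)
  fix M assume "M \<in> ?L"
  then have M: "perfect_matching V' E' M" "{b, d} \<in> M" by auto
  have ac: "{a, c} \<in> M" "{a, b} \<notin> M" using matching_cases[OF M(1)] M(2) by auto
  \<comment> \<open>Since \<open>c\<close> is matched by \<open>{a, c}\<close>, exchanging the two
    sides for \<open>{c, d}\<close> loses no information.\<close>
  have ncd: "{c, d} \<notin> M"
    using perfect_matchingD[OF M(1), of c "{a, c}" "{c, d}"] ac cd new_edges_distinct by auto
  define N where "N = insert {c, d} (M - {{a, c}, {b, d}})"
  have "\<exists>!e. e \<in> N \<and> v \<in> e" if v: "v \<in> V" for v
  proof -
    have ex: "\<exists>!e. e \<in> M \<and> v \<in> e" using M(1) v by (simp add: perfect_matching_def)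
    show ?thesis
    proof (cases "v = c \<or> v = d")
      case True
      have "v \<notin> e" if "e \<in> M - {{a, c}, {b, d}}" for e
        using True ex that ac(1) M(2) by blast
      then show ?thesis using True unfolding N_def by (intro ex1I[of _ "{c, d}"]) auto
    next
      case False
      then have "v \<notin> {a, c}" "v \<notin> {b, d}" "v \<notin> {c, d}" using v ab by auto
      then show ?thesis using ex unfolding N_def by blast
    qed
  qed
  moreover have "N \<subseteq> E" using M(1) ac cd by (auto simp: perfect_matching_def N_def)
  ultimately have "N \<in> ?R" by (auto simp: perfect_matching_def N_def)
  moreover have "M = ?f N" using M(2) ac ncd by (auto simp: N_def)
  ultimately show "M \<in> ?f ` ?R" by blast
next
  fix M assume "M \<in> ?f ` ?R"
  then obtain N where N: "perfect_matching V E N" "{c, d} \<in> N" and M: "M = ?f N" by blast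
  have sub: "N \<subseteq> E" using N by (simp add: perfect_matching_def)
  have "\<exists>!e. e \<in> M \<and> v \<in> e" if v: "v \<in> V'" for v
  proof (cases "v \<in> V")
    case True
    have ex: "\<exists>!e. e \<in> N \<and> v \<in> e" using N(1) True by (simp add: perfect_matching_def)
    consider "v = c" | "v = d" | "v \<notin> {c, d}" by auto
    then show ?thesis
    proof cases
      case 1
      then have "v \<notin> e" if "e \<in> N - {{c, d}}" for e using ex that N(2) by blast
      then show ?thesis using 1 True cd ab unfolding M by (intro ex1I[of _ "{a, c}"]) auto
    next
      case 2
      then have "v \<notin> e" if "e \<in> N - {{c, d}}" for e using ex that N(2) by blast
      then show ?thesis using 2 True cd ab unfolding M by (intro ex1I[of _ "{b, d}"]) auto
    next
      case 3
      then have "v \<notin> {a, c}" "v \<notin> {b, d}" "v \<notin> {c, d}" using True ab by auto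
      then show ?thesis using ex unfolding M by blast
    qed
  next
    case False
    have no: "v \<notin> e" if "e \<in> N" for e using that sub edges False by auto
    have "v = a \<or> v = b" using v False by auto
    then show ?thesis
    proof
      assume "v = a"
      then show ?thesis using no cd ab unfolding M by (intro ex1I[of _ "{a, c}"]) auto
    next
      assume "v = b"
      then show ?thesis using no cd ab unfolding M by (intro ex1I[of _ "{b, d}"]) auto
    qed
  qed
  moreover have "M \<subseteq> E'" using sub unfolding M by blast
  ultimately have "perfect_matching V' E' M" by (simp only: perfect_matching_def simp_thms ball_simps) blast
  moreover have "{b, d} \<in> M" unfolding M by blast
  ultimately show "M \<in> ?L" by simp
qed

lemma card_matchings_with_outer_edge:
  "card {M. perfect_matching V' E' M \<and> {a, b} \<in> M} = card {M. perfect_matching V E M}"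
  unfolding matchings_with_outer_edge
proof (rule card_image, rule inj_onI)
  fix M N assume *: "M \<in> {M. perfect_matching V E M}" "N \<in> {M. perfect_matching V E M}"
    "insert {a, b} M = insert {a, b} N"
  then have "M \<subseteq> E" "N \<subseteq> E" unfolding perfect_matching_def by blast+
  then have "{a, b} \<notin> M" "{a, b} \<notin> N" using new_edges_distinct(4) by blast+
  then show "M = N" using *(3) by (simp add: insert_ident)
qed

lemma card_matchings_with_side_edge:
  "card {M. perfect_matching V' E' M \<and> {b, d} \<in> M} =
    card {M. perfect_matching V E M \<and> {c, d} \<in> M}"
  unfolding matchings_with_side_edge
proof (rule card_image, rule inj_onI)
  fix M N assume *: "M \<in> {M. perfect_matching V E M \<and> {c, d} \<in> M}"
    "N \<in> {M. perfect_matching V E M \<and> {c, d} \<in> M}"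
    "insert {a, c} (insert {b, d} (M - {{c, d}})) = insert {a, c} (insert {b, d} (N - {{c, d}}))"
  have "M \<subseteq> E" "N \<subseteq> E" "{c, d} \<in> M" "{c, d} \<in> N"
    using *(1,2) unfolding perfect_matching_def by blast+
  moreover have "x \<in> M \<longleftrightarrow> x \<in> N" if "x \<noteq> {c, d}" "x \<noteq> {a, c}" "x \<noteq> {b, d}" for x
    using arg_cong[OF *(3), of "\<lambda>S. x \<in> S"] that by simp
  ultimately show "M = N" using new_edges_distinct(5,6) by (metis subset_antisym subsetD subsetI)
qed

lemma card_matchings:
  assumes "finite E"
  shows "card {M. perfect_matching V' E' M} =
    card {M. perfect_matching V E M} + card {M. perfect_matching V E M \<and> {c, d} \<in> M}"
proof -
  have "{M. perfect_matching V' E' M} =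
      {M. perfect_matching V' E' M \<and> {a, b} \<in> M} \<union> {M. perfect_matching V' E' M \<and> {b, d} \<in> M}"
    by (auto dest: matching_cases)
  moreover have "{M. perfect_matching V' E' M \<and> {a, b} \<in> M} \<inter> {M. perfect_matching V' E' M \<and> {b, d} \<in> M} = {}"
    by (auto dest: matching_cases)
  moreover have "finite {M. perfect_matching V' E' M}"
    by (rule finite_subset[of _ "Pow E'"]) (use assms in \<open>auto simp: perfect_matching_def\<close>)
  ultimately show ?thesis
    by (metis (no_types, lifting) card_Un_disjoint card_matchings_with_outer_edge
        card_matchings_with_side_edge finite_Un)
qed

end

section \<open>Adding tiles one at a time\<close>

abbreviation vertices_of :: "point set \<Rightarrow> point set" where
  "vertices_of T \<equiv> \<Union> (tile_vertices ` T)"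

abbreviation edges_of :: "point set \<Rightarrow> point set set" where
  "edges_of T \<equiv> \<Union> (tile_edges ` T)"

definition matchings :: "point set \<Rightarrow> point set set set" where
  "matchings T = {M. perfect_matching (vertices_of T) (edges_of T) M}"

definition matchings_with :: "point set \<Rightarrow> point set \<Rightarrow> point set set set" where
  "matchings_with T e = {M. perfect_matching (vertices_of T) (edges_of T) M \<and> e \<in> M}"

definition north_edge :: "point \<Rightarrow> point set" where
  "north_edge t = {(fst t, snd t + 1), (fst t + 1, snd t + 1)}"

definition east_edge :: "point \<Rightarrow> point set" where
  "east_edge t = {(fst t + 1, snd t), (fst t + 1, snd t + 1)}"

text \<open>
  \<open>tally T t (n, e)\<close> records, for a snake \<open>T\<close> with last tile \<open>t\<close>, the numbers \<open>n\<close> and \<open>e\<close> of perfect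
  matchings containing the north and the east edge of \<open>t\<close>; every matching contains exactly one of them.
\<close>
definition tally :: "point set \<Rightarrow> point \<Rightarrow> int \<times> int \<Rightarrow> bool" where
  "tally T t p \<longleftrightarrow> finite T \<and> t \<in> T \<and> (\<forall>t'\<in>T. fst t' \<le> fst t \<and> snd t' \<le> snd t) \<and>
     int (card (matchings_with T (north_edge t))) = fst p \<and>
     int (card (matchings_with T (east_edge t))) = snd p \<and>
     int (card (matchings T)) = fst p + snd p"

lemma edges_of_subset: "\<Union> (edges_of T) \<subseteq> vertices_of T"
  by (auto simp: tile_edges_def tile_vertices_def)

text \<open>The tile is glued onto its bottom edge, taken as a graph with one edge.\<close>

lemma tally_singleton: "tally {t} t (1, 1)"
proof -
  obtain i j where t: "t = (i, j)" by fastforce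
  define c d a b where "c = (i, j)" "d = (i + 1, j)" "a = (i, j + 1)" "b = (i + 1, j + 1)"
  note defs = this
  interpret glued_square "{c, d}" "{{c, d}}" a b c d by unfold_locales (auto simp: defs)
  have V: "vertices_of {t} = V'" and E: "edges_of {t} = E'"
    by (auto simp: t tile_vertices_def tile_edges_def defs)
  have pm: "perfect_matching {c, d} {{c, d}} M \<longleftrightarrow> M = {{c, d}}" for M
  proof
    assume "perfect_matching {c, d} {{c, d}} M"
    then have "M \<subseteq> {{c, d}}" "M \<noteq> {}" by (auto simp: perfect_matching_def)
    then show "M = {{c, d}}" by blast
  qed (auto simp: perfect_matching_def)
  have one: "{M. perfect_matching {c, d} {{c, d}} M} = {{{c, d}}}"
    "{M. perfect_matching {c, d} {{c, d}} M \<and> {c, d} \<in> M} = {{{c, d}}}"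
    by (auto simp: pm)
  have "north_edge t = {a, b}" "east_edge t = {b, d}"
    by (auto simp: north_edge_def east_edge_def t defs)
  then show ?thesis
    unfolding tally_def matchings_def matchings_with_def V E
    using card_matchings_with_outer_edge card_matchings_with_side_edge card_matchings
    by (simp add: one)
qed

text \<open>The glued edge is the old east edge. The new east edge extends every old matching; the
  new north edge occurs in those that come from a matching with the old east edge.\<close>

lemma tally_east:
  assumes T: "tally T (i, j) (n, e)"
  shows "tally (insert (i + 1, j) T) (i + 1, j) (e, n + e)"
proof -
  define c d a b where "c = (i + 1, j)" "d = (i + 1, j + 1)" "a = (i + 1 + 1, j)" "b = (i + 1 + 1, j + 1)"
  note defs = this
  have T': "finite T" "(i, j) \<in> T" "\<And>t'. t' \<in> T \<Longrightarrow> fst t' \<le> i \<and> snd t' \<le> j"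
    using T by (auto simp: tally_def)
  \<comment> \<open>No tile lies to the right of the last one, so \<open>a\<close> and
    \<open>b\<close> are new vertices.\<close>
  have bound: "fst v \<le> i + 1" if "v \<in> vertices_of T" for v
    using that T'(3) by (fastforce simp: tile_vertices_def)
  have cdV: "c \<in> vertices_of T" "d \<in> vertices_of T"
    using T'(2) by (intro UN_I[of "(i, j)"]; simp add: tile_vertices_def defs)+
  have cdE: "{c, d} \<in> edges_of T"
    using T'(2) by (intro UN_I[of "(i, j)"]) (auto simp: tile_edges_def defs)
  have "\<not> fst a \<le> i + 1" "\<not> fst b \<le> i + 1" by (simp_all add: defs)
  then have abV: "a \<notin> vertices_of T" "b \<notin> vertices_of T" using bound by blast+
  have ne: "c \<noteq> d" "a \<noteq> b" by (simp_all add: defs)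
  interpret glued_square "vertices_of T" "edges_of T" a b c d
    by (rule glued_square.intro[OF edges_of_subset cdV ne(1) cdE abV ne(2)])
  have V: "vertices_of (insert (i + 1, j) T) = V'"
  proof -
    have "tile_vertices (i + 1, j) = {a, b, c, d}" by (auto simp: tile_vertices_def defs)
    then show ?thesis unfolding image_insert Union_insert using cdV by blast
  qed
  have E: "edges_of (insert (i + 1, j) T) = E'"
  proof -
    have "tile_edges (i + 1, j) = {{c, a}, {a, b}, {b, d}, {d, c}}"
      by (simp add: tile_edges_def defs)
    also have "\<dots> = {{a, b}, {a, c}, {b, d}, {c, d}}"
      unfolding insert_commute[of c a] insert_commute[of d c] by blast
    finally have "tile_edges (i + 1, j) = {{a, b}, {a, c}, {b, d}, {c, d}}" .
    then show ?thesis unfolding image_insert Union_insert using cdE by blast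
  qed
  have fin: "finite (edges_of T)"
    using T'(1) by (intro finite_UN_I) (simp_all add: tile_edges_def case_prod_beta)
  have ed: "north_edge (i + 1, j) = {b, d}" "east_edge (i + 1, j) = {a, b}" "east_edge (i, j) = {c, d}"
    by (simp_all add: north_edge_def east_edge_def defs insert_commute)
  have "card (matchings_with (insert (i + 1, j) T) (north_edge (i + 1, j))) =
      card (matchings_with T (east_edge (i, j)))"
    unfolding matchings_with_def V E ed by (rule card_matchings_with_side_edge)
  moreover have "card (matchings_with (insert (i + 1, j) T) (east_edge (i + 1, j))) = card (matchings T)"
    unfolding matchings_with_def matchings_def V E ed by (rule card_matchings_with_outer_edge)
  moreover have "card (matchings (insert (i + 1, j) T)) =
      card (matchings T) + card (matchings_with T (east_edge (i, j)))"
    unfolding matchings_with_def matchings_def V E ed by (rule card_matchings[OF fin])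
  ultimately show ?thesis using T T' by (fastforce simp: tally_def)
qed

lemma tally_north:
  assumes T: "tally T (i, j) (n, e)"
  shows "tally (insert (i, j + 1) T) (i, j + 1) (n + e, n)"
proof -
  define c d a b where "c = (i, j + 1)" "d = (i + 1, j + 1)" "a = (i, j + 1 + 1)" "b = (i + 1, j + 1 + 1)"
  note defs = this
  have T': "finite T" "(i, j) \<in> T" "\<And>t'. t' \<in> T \<Longrightarrow> fst t' \<le> i \<and> snd t' \<le> j"
    using T by (auto simp: tally_def)
  have bound: "snd v \<le> j + 1" if "v \<in> vertices_of T" for v
    using that T'(3) by (fastforce simp: tile_vertices_def)
  have cdV: "c \<in> vertices_of T" "d \<in> vertices_of T"
    using T'(2) by (intro UN_I[of "(i, j)"]; simp add: tile_vertices_def defs)+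
  have cdE: "{c, d} \<in> edges_of T"
    using T'(2) by (intro UN_I[of "(i, j)"]) (auto simp: tile_edges_def defs)
  have "\<not> snd a \<le> j + 1" "\<not> snd b \<le> j + 1" by (simp_all add: defs)
  then have abV: "a \<notin> vertices_of T" "b \<notin> vertices_of T" using bound by blast+
  have ne: "c \<noteq> d" "a \<noteq> b" by (simp_all add: defs)
  interpret glued_square "vertices_of T" "edges_of T" a b c d
    by (rule glued_square.intro[OF edges_of_subset cdV ne(1) cdE abV ne(2)])
  have V: "vertices_of (insert (i, j + 1) T) = V'"
  proof -
    have "tile_vertices (i, j + 1) = {a, b, c, d}" by (auto simp: tile_vertices_def defs)
    then show ?thesis unfolding image_insert Union_insert using cdV by blast
  qed
  have E: "edges_of (insert (i, j + 1) T) = E'"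
  proof -
    have "tile_edges (i, j + 1) = {{c, d}, {d, b}, {b, a}, {a, c}}"
      by (simp add: tile_edges_def defs)
    also have "\<dots> = {{a, b}, {a, c}, {b, d}, {c, d}}"
      unfolding insert_commute[of d b] insert_commute[of b a] by blast
    finally have "tile_edges (i, j + 1) = {{a, b}, {a, c}, {b, d}, {c, d}}" .
    then show ?thesis unfolding image_insert Union_insert using cdE by blast
  qed
  have fin: "finite (edges_of T)"
    using T'(1) by (intro finite_UN_I) (simp_all add: tile_edges_def case_prod_beta)
  have ed: "north_edge (i, j + 1) = {a, b}" "east_edge (i, j + 1) = {b, d}" "north_edge (i, j) = {c, d}"
    by (simp_all add: north_edge_def east_edge_def defs insert_commute)
  have "card (matchings_with (insert (i, j + 1) T) (east_edge (i, j + 1))) =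
      card (matchings_with T (north_edge (i, j)))"
    unfolding matchings_with_def V E ed by (rule card_matchings_with_side_edge)
  moreover have "card (matchings_with (insert (i, j + 1) T) (north_edge (i, j + 1))) = card (matchings T)"
    unfolding matchings_with_def matchings_def V E ed by (rule card_matchings_with_outer_edge)
  moreover have "card (matchings (insert (i, j + 1) T)) =
      card (matchings T) + card (matchings_with T (north_edge (i, j)))"
    unfolding matchings_with_def matchings_def V E ed by (rule card_matchings[OF fin])
  ultimately show ?thesis using T T' by (fastforce simp: tally_def)
qed

section \<open>The snake of a lattice path\<close>

lemma staircase_mono:
  assumes "\<And>k. k < N \<Longrightarrow> unit_step (h k) (h (Suc k))" "k \<le> l" "l \<le> N"
  shows "fst (h k) \<le> fst (h l) \<and> snd (h k) \<le> snd (h l)"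
  using assms(2,3)
proof (induction l rule: dec_induct)
  case (step n)
  then show ?case using assms(1)[of n] by (auto simp: unit_step_def)
qed simp

text \<open>A path that touches the tile and has a point weakly below and to the right of its
  south-east vertex must run through this vertex.\<close>

lemma tile_on_staircase_iff:
  assumes st: "\<And>k. k < N \<Longrightarrow> unit_step (h k) (h (Suc k))"
  shows "(\<forall>v\<in>tile_vertices (i, j). weakly_above_left (h ` {..N}) v) \<and>
      tile_vertices (i, j) \<inter> h ` {..N} \<noteq> {}
    \<longleftrightarrow> (i + 1, j) \<in> h ` {..N}" (is "?A \<longleftrightarrow> ?B")
proof
  assume ?B
  then have "weakly_above_left (h ` {..N}) v" if "v \<in> tile_vertices (i, j)" for v
    unfolding weakly_above_left_def using that
    by (elim bexI[rotated]) (auto simp: tile_vertices_def)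
  moreover have "(i + 1, j) \<in> tile_vertices (i, j)" by (simp add: tile_vertices_def)
  ultimately show ?A using \<open>?B\<close> by blast
next
  note mono = staircase_mono[of N h, OF st]
  assume ?A
  moreover have "(i + 1, j) \<in> tile_vertices (i, j)" by (simp add: tile_vertices_def)
  ultimately obtain k where k: "k \<le> N" "i + 1 \<le> fst (h k)" "snd (h k) \<le> j"
    by (fastforce simp: weakly_above_left_def)
  obtain l where l: "l \<le> N" "h l \<in> tile_vertices (i, j)" using \<open>?A\<close> by blast
  have kl: "k < l \<or> k = l \<or> l < k" by auto
  consider "h l = (i, j)" | "h l = (i + 1, j)" | "h l = (i + 1, j + 1)" | "h l = (i, j + 1)"
    using l(2) by (auto simp: tile_vertices_def)
  then show ?B
  proof cases
    case 1
    then have "l < k" using kl k mono[of k l] l by fastforce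
    then have "unit_step (h l) (h (Suc l))" "snd (h (Suc l)) \<le> j"
      using st[of l] mono[of "Suc l" k] k by auto
    then have "h (Suc l) = (i + 1, j)" using 1 by (auto simp: unit_step_def)
    then show ?thesis using \<open>l < k\<close> k(1) by (intro image_eqI[of _ _ "Suc l"]) auto
  next
    case 2
    then show ?thesis using l(1) by (intro image_eqI[of _ _ l]) auto
  next
    case 3
    then have "k < l" using kl k mono[of l k] l by fastforce
    then obtain l' where l': "l = Suc l'" by (cases l) auto
    then have "unit_step (h l') (h l)" "i + 1 \<le> fst (h l')"
      using st[of l'] mono[of k l'] k l \<open>k < l\<close> by auto
    then have "h l' = (i + 1, j)" using 3 by (cases "h l'") (auto simp: unit_step_def)
    then show ?thesis using l' l(1) by (intro image_eqI[of _ _ l']) auto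
  next
    case 4
    then have "l < k" using kl k mono[of k l] l by fastforce
    then show ?thesis using mono[of l k] k 4 by auto
  qed
qed

text \<open>In doubled coordinates, even indices give the lattice points and odd indices the
  midpoints of the steps.\<close>

definition half_step :: "point list \<Rightarrow> nat \<Rightarrow> point" where
  "half_step L k =
     (fst (L ! (k div 2)) + fst (L ! (Suc k div 2)), snd (L ! (k div 2)) + snd (L ! (Suc k div 2)))"

lemma half_points_eq:
  assumes L: "length L = Suc n"
  shows "half_points L = half_step L ` {..2 * n}"
proof (intro equalityI subsetI)
  fix v assume "v \<in> half_points L"
  then consider x y where "v = (2 * x, 2 * y)" "(x, y) \<in> set L"
    | k where "Suc k < length L" "v = (fst (L ! k) + fst (L ! Suc k), snd (L ! k) + snd (L ! Suc k))"
    by (auto simp: half_points_def)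
  then show "v \<in> half_step L ` {..2 * n}"
  proof cases
    case 1
    then obtain k where "k < length L" "L ! k = (x, y)" by (auto simp: in_set_conv_nth)
    then show ?thesis using 1 L by (intro image_eqI[of _ _ "2 * k"]) (auto simp: half_step_def)
  next
    case 2
    then show ?thesis using L by (intro image_eqI[of _ _ "2 * k + 1"]) (auto simp: half_step_def)
  qed
next
  fix v assume "v \<in> half_step L ` {..2 * n}"
  then obtain k where k: "k \<le> 2 * n" "v = half_step L k" by auto
  show "v \<in> half_points L"
  proof (cases "even k")
    case True
    then obtain m where m: "k = 2 * m" by blast
    obtain x y where xy: "L ! m = (x, y)" by fastforce
    have "L ! m \<in> set L" using k L m by simp
    moreover have "v = (2 * x, 2 * y)" using k m xy by (simp add: half_step_def)
    ultimately show ?thesis unfolding half_points_def xy by blast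
  next
    case False
    then obtain m where m: "k = 2 * m + 1" by (metis oddE)
    then have "Suc m < length L" using k L by simp
    moreover have "v = (fst (L ! m) + fst (L ! Suc m), snd (L ! m) + snd (L ! Suc m))"
      using k m by (simp add: half_step_def)
    ultimately show ?thesis unfolding half_points_def by blast
  qed
qed

lemma half_step_unit_step:
  assumes "\<And>k. k < n \<Longrightarrow> unit_step (L ! k) (L ! Suc k)" "k < 2 * n"
  shows "unit_step (half_step L k) (half_step L (Suc k))"
proof -
  have "unit_step (L ! (k div 2)) (L ! Suc (k div 2))" using assms by simp
  then show ?thesis by (cases "even k") (auto simp: half_step_def unit_step_def elim!: evenE oddE)
qed

text \<open>The path point is the south-east vertex of the tile; the offset 2 skips the initial east
  step.\<close>

definition snake_tile :: "point list \<Rightarrow> nat \<Rightarrow> point" where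
  "snake_tile L k = (fst (half_step L (k + 2)) - 1, snd (half_step L (k + 2)))"

text \<open>The coordinate bounds discard the half points \<open>0\<close>, \<open>1\<close> and
  those after \<open>2 * n + 2\<close>, which belong to the initial east and the final north
  step.\<close>

lemma snake_tiles_eq:
  fixes r s n
  defines "L \<equiv> lower_path r s"
  assumes r: "0 < r" and s: "0 < s" and len: "length L = Suc (Suc (Suc n))"
    and st: "\<And>k. k < Suc (Suc n) \<Longrightarrow> unit_step (L ! k) (L ! Suc k)"
    and L0: "L ! 0 = (0, 0)" "L ! 1 = (1, 0)" "L ! Suc n = (s, r - 1)" "L ! Suc (Suc n) = (s, r)"
  shows "snake_tiles r s = snake_tile L ` {..2 * n}"
proof -
  define N where "N = 2 * Suc (Suc n)"
  have H: "half_points L = half_step L ` {..N}" using half_points_eq[OF len] N_def by simp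
  have st': "unit_step (half_step L k) (half_step L (Suc k))" if "k < N" for k
    using half_step_unit_step[of "Suc (Suc n)" L k] st that N_def by auto
  note mono = staircase_mono[of N "half_step L", OF st']
  have h: "half_step L 0 = (0, 0)" "half_step L 1 = (1, 0)" "half_step L 2 = (2, 0)"
    "half_step L (2 * n + 2) = (2 * s, 2 * r - 2)" "half_step L (2 * n + 3) = (2 * s, 2 * r - 1)"
    using L0 by (simp_all add: half_step_def)
  have on: "(i, j) \<in> tiles_on_path r s \<longleftrightarrow>
      tile_vertices (i, j) \<subseteq> {0..2 * s} \<times> {0..2 * r} \<and> (i + 1, j) \<in> half_step L ` {..N}" for i j
    unfolding tiles_on_path_def L_def[symmetric] H mem_Collect_eq
    using tile_on_staircase_iff[of N "half_step L" i j, OF st'] by blast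
  have box: "0 \<le> fst (half_step L k) \<and> fst (half_step L k) \<le> 2 * s \<and> 0 \<le> snd (half_step L k)"
    if "k \<le> N" for k
  proof -
    have "half_step L N = (2 * s, 2 * r)" using L0 by (simp add: half_step_def N_def)
    then show ?thesis using mono[of 0 k] mono[of k N] that h by simp
  qed
  show ?thesis
  proof (intro equalityI subsetI)
    fix t assume t: "t \<in> snake_tiles r s"
    obtain i j where ij: "t = (i, j)" by fastforce
    then obtain k where k: "k \<le> N" "half_step L k = (i + 1, j)" and b: "1 \<le> i" "j \<le> 2 * r - 2"
      using t on[of i j] by (auto simp: snake_tiles_def)
    have "2 \<le> k"
    proof (rule ccontr)
      assume "\<not> 2 \<le> k"
      then have "k = 0 \<or> k = 1" by auto
      then show False using k(2) b(1) h by auto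
    qed
    moreover have "k \<le> 2 * n + 2"
    proof (rule ccontr)
      assume "\<not> k \<le> 2 * n + 2"
      then show False using mono[of "2 * n + 3" k] k b(2) h by simp
    qed
    moreover from \<open>2 \<le> k\<close> have "t = snake_tile L (k - 2)"
      using k ij by (simp only: snake_tile_def le_add_diff_inverse2 fst_conv snd_conv add_diff_cancel_right')
    ultimately show "t \<in> snake_tile L ` {..2 * n}" by (intro image_eqI[of _ _ "k - 2"]) auto
  next
    fix t assume "t \<in> snake_tile L ` {..2 * n}"
    then obtain k where k: "k \<le> 2 * n" "t = snake_tile L k" by auto
    obtain i j where ij: "half_step L (k + 2) = (i + 1, j)"
      by (metis diff_add_cancel surj_pair)
    have kN: "k + 2 \<le> N" using k N_def by simp
    have "2 \<le> i + 1" using mono[of 2 "k + 2"] h(3) ij kN by simp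
    moreover have "j \<le> 2 * r - 2" using mono[of "k + 2" "2 * n + 2"] h(4) ij k N_def by simp
    moreover have "i + 1 \<le> 2 * s" "0 \<le> j" using box[OF kN] ij by auto
    moreover have "(i + 1, j) \<in> half_step L ` {..N}" using ij kN by (metis atMost_iff image_eqI)
    ultimately have "(i, j) \<in> snake_tiles r s"
      unfolding snake_tiles_def using on[of i j] by (auto simp: tile_vertices_def)
    then show "t \<in> snake_tiles r s" using k(2) ij by (simp add: snake_tile_def)
  qed
qed

definition east_letter :: "point list \<Rightarrow> nat \<Rightarrow> bool" where
  "east_letter L k \<longleftrightarrow> L ! Suc k = (fst (L ! k) + 1, snd (L ! k))"

text \<open>Each inner letter adds two tiles. \<open>vec\<close> applies the last letter of a list
  first, hence the reversal; index 0 is the initial east step.\<close>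

lemma tally_snake:
  assumes st: "\<And>k. k < Suc (Suc n) \<Longrightarrow> unit_step (L ! k) (L ! Suc k)" and "m \<le> n"
  shows "tally (snake_tile L ` {..2 * m}) (snake_tile L (2 * m))
    (vec (rev (map (east_letter L) [1..<Suc m])))"
  using assms(2)
proof (induction m)
  case 0
  then show ?case by (simp add: tally_singleton)
next
  case (Suc m)
  obtain i j where ij: "snake_tile L (2 * m) = (i, j)" by fastforce
  obtain a b where ab: "vec (rev (map (east_letter L) [1..<Suc m])) = (a, b)" by fastforce
  have IH: "tally (snake_tile L ` {..2 * m}) (i, j) (a, b)" using Suc ij ab by simp
  have T: "snake_tile L ` {..2 * Suc m} =
      insert (snake_tile L (2 * m + 2)) (insert (snake_tile L (2 * m + 1)) (snake_tile L ` {..2 * m}))"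
    by (simp add: atMost_Suc)
  have v: "vec (rev (map (east_letter L) [1..<Suc (Suc m)])) = step (east_letter L (Suc m)) (a, b)"
    using ab by simp
  have us: "unit_step (L ! Suc m) (L ! Suc (Suc m))" using st[of "Suc m"] Suc.prems by simp
  show ?case
  proof (cases "east_letter L (Suc m)")
    case True
    have "snake_tile L (2 * m + 1) = (i + 1, j)" "snake_tile L (2 * m + 2) = (i + 1 + 1, j)"
      using ij True by (auto simp: snake_tile_def half_step_def east_letter_def)
    then show ?thesis
      using tally_east[OF tally_east[OF IH]] T v True by (simp add: algebra_simps)
  next
    case False
    then have "L ! Suc (Suc m) = (fst (L ! Suc m), snd (L ! Suc m) + 1)"
      using us by (auto simp: unit_step_def east_letter_def)
    then have "snake_tile L (2 * m + 1) = (i, j + 1)" "snake_tile L (2 * m + 2) = (i, j + 1 + 1)"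
      using ij by (auto simp: snake_tile_def half_step_def)
    then show ?thesis
      using tally_north[OF tally_north[OF IH]] T v False by (simp add: algebra_simps)
  qed
qed

text \<open>The word omits the initial east and the final north step, hence the counts reduced by
  one and the starting value \<open>r\<close>.\<close>

lemma snake_word_exists:
  assumes r: "0 < r" and s: "0 < s"
  obtains w where "int (snake_m r s) = weight w"
    and "int (count_list w True) = s - 1" "int (count_list w False) = r - 1"
    and "\<And>u v. w = u @ v \<Longrightarrow> 0 \<le> r + phi r s u \<and> phi r s u < s"
proof -
  define L where "L = lower_path r s"
  have L: "is_lower_path r s L" using is_lower_path_lower_path[OF r s] by (simp add: L_def)
  define n where "n = nat (r + s - 2)"
  have len: "length L = Suc (Suc (Suc n))"
    using is_lower_path_length[OF L] r s n_def by linarith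
  have st: "unit_step (L ! k) (L ! Suc k)" if "k < Suc (Suc n)" for k
    using L that len by (simp add: is_lower_path_def lattice_path_def successively_conv_nth)
  have below: "s * snd (L ! k) \<le> r * fst (L ! k)" if "k < length L" for k
    using L nth_mem[OF that] unfolding is_lower_path_def by (cases "L ! k") auto
  have L0: "L ! 0 = (0, 0)" and Ln: "L ! Suc (Suc n) = (s, r)"
    using L len by (auto simp: is_lower_path_def lattice_path_def hd_conv_nth last_conv_nth)
  have L1: "L ! 1 = (1, 0)" using is_lower_path_step[OF L _ L0 s] len s by simp
  have Ln1: "L ! Suc n = (s, r - 1)"
  proof -
    have "unit_step (L ! Suc n) (s, r)" using st[of "Suc n"] Ln by simp
    then have "L ! Suc n = (s - 1, r) \<or> L ! Suc n = (s, r - 1)"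
      by (cases "L ! Suc n") (auto simp: unit_step_def)
    then show ?thesis using below[of "Suc n"] len r by (auto simp: algebra_simps)
  qed
  \<comment> \<open>The path turns north whenever the form is at least \<open>s\<close>, so east
    steps start below \<open>s\<close>.\<close>
  have above: "r * fst (L ! k) - s * snd (L ! k) < r + s" if "k < length L" for k
    using that
  proof (induction k)
    case 0
    then show ?case using L0 r s by simp
  next
    case (Suc k)
    obtain x y where xy: "L ! k = (x, y)" by fastforce
    show ?case using is_lower_path_step[OF L Suc.prems xy s] Suc xy s by (auto simp: algebra_simps)
  qed
  define w where "w = map (east_letter L) [1..<Suc n]"
  have pos: "L ! Suc k = (1 + int (count_list (take k w) True), int (count_list (take k w) False))"
    if "k \<le> n" for k
    using that
  proof (induction k)
    case 0
    then show ?case using L1 by simp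
  next
    case (Suc k)
    have "take (Suc k) w = take k w @ [east_letter L (Suc k)]"
      using Suc.prems by (simp add: w_def take_Suc_conv_app_nth del: upt_Suc)
    then show ?case using Suc st[of "Suc k"] by (auto simp: unit_step_def east_letter_def)
  qed
  have lw: "length w = n" by (simp add: w_def)
  show thesis
  proof
    have "tally (snake_tiles r s) (snake_tile L (2 * n)) (vec (rev w))"
      using tally_snake[OF st order_refl] snake_tiles_eq[OF r s, of n] len st L0 L1 Ln1 Ln
      by (simp add: L_def w_def del: upt_Suc)
    moreover have "snake_m r s = card (matchings (snake_tiles r s))"
      by (simp add: snake_m_def matchings_def snake_vertices_def snake_edges_def)
    ultimately have "int (snake_m r s) = weight (rev w)" by (simp add: tally_def weight_def)
    then show "int (snake_m r s) = weight w" by (simp add: weight_rev)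
    show "int (count_list w True) = s - 1" "int (count_list w False) = r - 1"
      using pos[of n] Ln1 lw by simp_all
    fix u v assume "w = u @ v"
    then have u: "u = take (length u) w" "length u \<le> n" using lw by auto
    define k where "k = length u"
    have "r + phi r s u = r * fst (L ! Suc k) - s * snd (L ! Suc k)"
      using pos[of k] u by (simp add: phi_count_list k_def algebra_simps)
    moreover have "Suc k < length L" using u(2) len by (simp add: k_def)
    ultimately show "0 \<le> r + phi r s u \<and> phi r s u < s"
      using below[of "Suc k"] above[of "Suc k"] by linarith
  qed
qed

section \<open>The two inequalities\<close>

text \<open>Without \<open>b\<close> the word has the same letters as the word of
  \<open>r / s\<close>, the lightest of its kind.\<close>

lemma snake_m_less_of_insert:
  assumes r: "0 < r" and s: "0 < s" and w: "int N = weight (u @ b # v)"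
    and "int (count_list (u @ v) True) = s - 1" "int (count_list (u @ v) False) = r - 1"
  shows "snake_m r s < N"
proof -
  obtain x where x: "int (snake_m r s) = weight x"
    "int (count_list x True) = s - 1" "int (count_list x False) = r - 1"
    "\<And>u v. x = u @ v \<Longrightarrow> 0 \<le> r + phi r s u \<and> phi r s u < s"
    using snake_word_exists[OF r s] by blast
  have "phi r s x = s - r" unfolding phi_count_list x(2,3) by (simp add: algebra_simps)
  moreover have "count_list (u @ v) = count_list x"
  proof
    fix b show "count_list (u @ v) b = count_list x b"
      using assms(4,5) x(2,3) by (cases b) auto
  qed
  ultimately have "weight x \<le> weight (u @ v)"
    using christoffel_minimal[OF r s, of x] x(4) by blast
  also have "\<dots> < weight (u @ b # v)" by (rule weight_insert_letter)
  finally show ?thesis using x(1) w by simp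
qed

theorem theorem4p6:
  fixes p q :: int
  assumes "0 < p" and "p < q"
  shows "snake_m p q < snake_m p (q + 1) \<and> snake_m p q < snake_m (p + 1) q"
proof -
  have split: "\<exists>u v. w = u @ b # v" if "0 < int (count_list w b)" for w :: "bool list" and b
    using that by (metis count_notin of_nat_0 order_less_irrefl split_list)
  have q: "0 < q" "0 < q + 1" "0 < p + 1" using assms by auto
  obtain w where w: "int (snake_m p (q + 1)) = weight w"
    "int (count_list w True) = q + 1 - 1" "int (count_list w False) = p - 1"
    using snake_word_exists[OF assms(1) q(2)] by blast
  then obtain u v where "w = u @ True # v" using split[of w True] q by auto
  then have 1: "snake_m p q < snake_m p (q + 1)"
    using snake_m_less_of_insert[OF assms(1) q(1), of _ u True v] w by simp
  obtain w where w: "int (snake_m (p + 1) q) = weight w"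
    "int (count_list w True) = q - 1" "int (count_list w False) = p + 1 - 1"
    using snake_word_exists[OF q(3) q(1)] by blast
  then obtain u v where "w = u @ False # v" using split[of w False] assms by auto
  then have "snake_m p q < snake_m (p + 1) q"
    using snake_m_less_of_insert[OF assms(1) q(1), of _ u False v] w by simp
  with 1 show ?thesis by blast
qed

end
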